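(* Let $\mathcal{H}$ be the $3\times 3$ grid graph. Then the MLE in the Gaussian graphical model on $\mathcal{H}$ exists with probability one for $n\ge 3$ observations, and the MLE does not exist for $n<2$ observations (i.e. for $n=1$).
   Context: The $3\times3$ grid is the graph with vertex set $\{1,2,3\}\times\{1,2,3\}$ (nine vertices) in which $(a,b)$ and $(c,d)$ are adjacent if and only if $|a-c|+|b-d|=1$. For an undirected graph $G$ with $m$ vertices (labeled by $[m]=\{1,\dots,m\}$) and edge set $E$, where $E$ is taken to contain all self-loops $(i,i)$, the (mean zero) Gaussian graphical model on $G$ is the family of distributions $\mathcal{N}(0,\Sigma)$ on $\mathbb{R}^m$ with $\Sigma$ symmetric positive definite and $(\Sigma^{-1})_{ij}=0$ for all $(i,j)\notin E$. Let $\mathcal{K}_G$ be the set of symmetric positive definite $m\times m$ matrices $K$ with $K_{ij}=0$ for all $(i,j)\notin E$. Given observations $X_1,\dots,X_n\in\mathbb{R}^m$, the sample covariance matrix is $S=\frac1n\sum_{k=1}^n X_kX_k^T$ (the mean is known to be zero). The maximum likelihood estimator (MLE) exists for these observations if the log-likelihood $K\mapsto \log\det K-\operatorname{tr}(SK)$ attains its maximum over $\mathcal{K}_G$; by a theorem of Dempster this holds if and only if there is a positive definite matrix $\hat\Sigma$ with $\hat\Sigma_{ij}=S_{ij}$ for all $(i,j)\in E$ (diagonal entries included). "The MLE exists with probability one for $n$ observations" means that it exists almost surely when $X_1,\dots,X_n$ are independent draws from a distribution $\mathcal{N}(0,\Sigma)$ in the model. *)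

theory Defs
  imports "HOL-Probability.Probability"
begin

definition pos_def_matrix :: "real ^ 'm ^ 'm \<Rightarrow> bool" where
  "pos_def_matrix A \<longleftrightarrow> transpose A = A \<and> (\<forall>x. x \<noteq> 0 \<longrightarrow> 0 < x \<bullet> (A *v x))"

text \<open>
  A graph on the vertex type \<open>'m\<close> is given by its adjacency relation. The edge set of the
  associated Gaussian graphical model contains in addition all self-loops.
\<close>

definition model_edges :: "'m rel \<Rightarrow> 'm rel" where
  "model_edges G = G \<union> Id"

definition concentration_matrices :: "'m rel \<Rightarrow> (real ^ 'm ^ 'm) set" where
  "concentration_matrices G =
     {K. pos_def_matrix K \<and> (\<forall>i j. (i, j) \<notin> model_edges G \<longrightarrow> K $ i $ j = 0)}"

text \<open>
  The centred normal distribution with positive definite covariance matrix \<open>\<Sigma>\<close>, given by its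
  Lebesgue density.
\<close>

definition centred_normal :: "real ^ 'm ^ 'm \<Rightarrow> (real ^ 'm) measure" where
  "centred_normal \<Sigma> = density lborel (\<lambda>x. ennreal
     (exp (- (x \<bullet> (matrix_inv \<Sigma> *v x)) / 2) / sqrt ((2 * pi) ^ CARD('m) * det \<Sigma>)))"

definition gaussian_graphical_model :: "'m rel \<Rightarrow> (real ^ 'm) measure set" where
  "gaussian_graphical_model G =
     {centred_normal \<Sigma> | \<Sigma>. pos_def_matrix \<Sigma> \<and>
        (\<forall>i j. (i, j) \<notin> model_edges G \<longrightarrow> matrix_inv \<Sigma> $ i $ j = 0)}"

text \<open>The mean is known to be zero, so the observations \<open>x 1, \<dots>, x n\<close> are not centred.\<close>

definition sample_covariance :: "nat \<Rightarrow> (nat \<Rightarrow> real ^ 'm) \<Rightarrow> real ^ 'm ^ 'm" where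
  "sample_covariance n x = (1 / real n) *\<^sub>R (\<Sum>k = 1..n. \<chi> i j. x k $ i * x k $ j)"

definition log_likelihood :: "real ^ 'm ^ 'm \<Rightarrow> real ^ 'm ^ 'm \<Rightarrow> real" where
  "log_likelihood S K = ln (det K) - trace (S ** K)"

definition mle_exists :: "'m rel \<Rightarrow> nat \<Rightarrow> (nat \<Rightarrow> real ^ 'm) \<Rightarrow> bool" where
  "mle_exists G n x \<longleftrightarrow>
     (\<exists>K \<in> concentration_matrices G. \<forall>K' \<in> concentration_matrices G.
        log_likelihood (sample_covariance n x) K' \<le> log_likelihood (sample_covariance n x) K)"

text \<open>
  The vertex set of the grid is made a type so that it can index vectors and matrices. Integer
  coordinates avoid truncated subtraction in the adjacency condition.
\<close>

typedef grid_vertex = "{1..3::int} \<times> {1..3::int}"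
  by (rule exI [of _ "(1, 1)"]) simp

instance grid_vertex :: finite
proof
  have "(UNIV :: grid_vertex set) = Abs_grid_vertex ` ({1..3} \<times> {1..3})"
    by (rule type_definition.Abs_image [OF type_definition_grid_vertex, symmetric])
  then show "finite (UNIV :: grid_vertex set)"
    by (metis finite_SigmaI finite_atLeastAtMost_int finite_imageI)
qed

definition grid_graph :: "grid_vertex rel" where
  "grid_graph = {(u, v). case (Rep_grid_vertex u, Rep_grid_vertex v) of
     ((a, b), (c, d)) \<Rightarrow> \<bar>a - c\<bar> + \<bar>b - d\<bar> = 1}"

end

theory Submission
  imports Defs
begin

text \<open>
  On the cone of positive semidefinite matrices supported on the graph, the likelihood attains its
  maximum unless some nonzero matrix \<open>K\<close> of the cone annihilates all observations. For three
  observations in general position no such \<open>K\<close> exists on the grid: writing \<open>v\<^sub>i \<in> \<real>\<^sup>3\<close> for the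
  \<open>i\<close>-th coordinates of the observations, row \<open>i\<close> of \<open>K\<close> gives a linear relation between \<open>v\<^sub>i\<close> and
  the \<open>v\<^sub>j\<close> with \<open>j\<close> adjacent to \<open>i\<close>, and any three of these vectors are independent. Hence the
  rows of the corners (two neighbours) vanish, then those of the edge midpoints (only the centre is
  left as a neighbour), then that of the centre. For a single observation \<open>x\<close> there is a nonzero
  vector \<open>u\<close> orthogonal to \<open>x\<close> and supported on an edge; adding \<open>u u\<^sup>T\<close> to a concentration matrix
  leaves the trace term unchanged and increases the determinant, so there is no maximum.
\<close>

subsection \<open>Positive semidefinite matrices\<close>

definition pos_semidef_matrix :: "real ^ 'm ^ 'm \<Rightarrow> bool" where
  "pos_semidef_matrix A \<longleftrightarrow> transpose A = A \<and> (\<forall>x. 0 \<le> x \<bullet> (A *v x))"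

lemma pos_def_imp_pos_semidef: "pos_def_matrix A \<Longrightarrow> pos_semidef_matrix A"
  unfolding pos_def_matrix_def pos_semidef_matrix_def
  by (metis inner_zero_left less_eq_real_def)

lemma inner_matrix_vector_transpose:
  fixes A :: "real ^ 'n ^ 'm"
  shows "x \<bullet> (A *v y) = (transpose A *v x) \<bullet> y"
  by (metis dot_lmul_matrix transpose_matrix_vector)

text \<open>Along the line \<open>x + t *\<^sub>R y\<close> with \<open>y = A *v x\<close>, the form
  has no constant term, so for small negative \<open>t\<close> the linear term would make it
  negative unless \<open>y = 0\<close>.\<close>

lemma pos_semidef_kernel:
  fixes A :: "real ^ 'm ^ 'm"
  assumes A: "pos_semidef_matrix A" and x: "x \<bullet> (A *v x) = 0"
  shows "A *v x = 0"
proof (rule ccontr)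
  assume "A *v x \<noteq> 0"
  define y where "y = A *v x"
  define b where "b = y \<bullet> (A *v y)"
  have pos: "0 < y \<bullet> y" using \<open>A *v x \<noteq> 0\<close> by (simp add: y_def)
  have sym: "x \<bullet> (A *v y) = y \<bullet> y"
    using A by (simp add: inner_matrix_vector_transpose pos_semidef_matrix_def y_def)
  have "0 \<le> (x + t *\<^sub>R y) \<bullet> (A *v (x + t *\<^sub>R y))" for t
    using A by (simp add: pos_semidef_matrix_def)
  also have "(x + t *\<^sub>R y) \<bullet> (A *v (x + t *\<^sub>R y)) = 2 * t * (y \<bullet> y) + t\<^sup>2 * b" for t
    using x sym
    by (simp add: matrix_vector_right_distrib matrix_vector_mult_scaleR inner_add_left
        inner_add_right b_def power2_eq_square algebra_simps flip: y_def)
  finally have quad: "0 \<le> 2 * t * (y \<bullet> y) + t\<^sup>2 * b" for t .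
  have "0 \<le> b" using A by (simp add: b_def pos_semidef_matrix_def)
  \<comment> \<open>The summand 1 avoids division by zero when \<open>b = 0\<close> and gives
    \<open>s * b < y \<bullet> y\<close>, so the quadratic is negative at
    \<open>t = - s\<close>.\<close>
  define s where "s = y \<bullet> y / (b + 1)"
  have "0 < s" "s * b < y \<bullet> y"
    using pos \<open>0 \<le> b\<close> by (simp_all add: s_def field_simps)
  moreover have "0 \<le> s * (s * b - 2 * (y \<bullet> y))"
    using quad [of "- s"] by (simp add: power2_eq_square algebra_simps)
  ultimately show False
    using pos by (simp add: zero_le_mult_iff)
qed

text \<open>By \<open>pos_semidef_kernel\<close>, a semidefinite form vanishes exactly on the kernel
  of its matrix.\<close>

lemma pos_def_iff_invertible:
  fixes A :: "real ^ 'm ^ 'm"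
  shows "pos_def_matrix A \<longleftrightarrow> pos_semidef_matrix A \<and> det A \<noteq> 0"
proof -
  have "det A \<noteq> 0 \<longleftrightarrow> (\<forall>x. A *v x = 0 \<longrightarrow> x = 0)"
    by (metis invertible_det_nz invertible_left_inverse matrix_left_invertible_ker)
  then show ?thesis
    by (metis less_eq_real_def pos_def_imp_pos_semidef pos_def_matrix_def inner_zero_right
        pos_semidef_kernel pos_semidef_matrix_def less_irrefl)
qed

lemma pos_def_add_pos_semidef:
  assumes "pos_def_matrix A" "pos_semidef_matrix B"
  shows "pos_def_matrix (A + B)"
proof -
  have "transpose (A + B) = transpose A + transpose B"
    by (simp add: transpose_def vec_eq_iff)
  with assms show ?thesis
    by (auto simp: pos_def_matrix_def pos_semidef_matrix_def matrix_vector_mult_add_rdistrib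
        inner_add_right intro: add_pos_nonneg)
qed

lemma pos_def_scaleR:
  assumes "pos_def_matrix A" "0 < c"
  shows "pos_def_matrix (c *\<^sub>R A)"
proof -
  have "transpose (c *\<^sub>R A) = c *\<^sub>R transpose A"
    by (simp add: transpose_def vec_eq_iff)
  with assms show ?thesis
    by (auto simp: pos_def_matrix_def simp flip: scaleR_matrix_vector_assoc)
qed

lemma pos_def_mat_1: "pos_def_matrix (mat 1)"
  by (simp add: pos_def_matrix_def)

lemma pos_semidef_scaleR:
  assumes "pos_semidef_matrix A" "0 \<le> c"
  shows "pos_semidef_matrix (c *\<^sub>R A)"
proof -
  have "transpose (c *\<^sub>R A) = c *\<^sub>R transpose A"
    by (simp add: transpose_def vec_eq_iff)
  with assms show ?thesis
    by (auto simp: pos_semidef_matrix_def simp flip: scaleR_matrix_vector_assoc)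
qed

lemma continuous_on_det [continuous_intros]:
  fixes f :: "'a::topological_space \<Rightarrow> real ^ 'm ^ 'm"
  assumes "continuous_on S f"
  shows "continuous_on S (\<lambda>x. det (f x))"
  unfolding det_def by (intro continuous_intros assms)

lemma continuous_on_matrix_vector_mult [continuous_intros]:
  fixes f :: "'a::topological_space \<Rightarrow> real ^ 'n ^ 'm"
  assumes "continuous_on S f"
  shows "continuous_on S (\<lambda>x. f x *v v)"
  unfolding matrix_vector_mult_def by (intro continuous_intros assms)

text \<open>The segment from the identity to \<open>A\<close> stays among the invertible matrices.\<close>

lemma pos_def_det_pos:
  fixes A :: "real ^ 'm ^ 'm"
  assumes A: "pos_def_matrix A"
  shows "0 < det A"
proof (rule ccontr)
  assume "\<not> 0 < det A"
  define B :: "real \<Rightarrow> real ^ 'm ^ 'm" where "B t = (1 - t) *\<^sub>R mat 1 + t *\<^sub>R A" for t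
  have "continuous_on {0..1} (\<lambda>t. det (B t))"
    unfolding B_def by (intro continuous_intros)
  moreover have "det (B 1) \<le> 0" "0 \<le> det (B 0)"
    using \<open>\<not> 0 < det A\<close> by (simp_all add: B_def)
  ultimately obtain t where t: "0 \<le> t" "t \<le> 1" "det (B t) = 0"
    using IVT2' [of "\<lambda>t. det (B t)" 1 0 0] by auto
  have "pos_def_matrix (B t)"
  \<comment> \<open>For \<open>t < 1\<close> the multiple of the identity is already positive
    definite; at \<open>t = 1\<close> it disappears and \<open>B t\<close> is
    \<open>A\<close>.\<close>
  proof (cases "t = 1")
    case True
    then show ?thesis using A by (simp add: B_def)
  next
    case False
    with t A show ?thesis
      unfolding B_def
      by (intro pos_def_add_pos_semidef pos_def_scaleR pos_def_mat_1 pos_semidef_scaleR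
          pos_def_imp_pos_semidef) auto
  qed
  with t show False by (simp add: pos_def_iff_invertible)
qed

text \<open>A crude Leibniz bound: only polynomial growth matters, to be beaten by exponential decay
  in \<open>mle_existsI\<close>.\<close>

lemma det_le_norm_power:
  fixes A :: "real ^ 'm ^ 'm"
  shows "\<bar>det A\<bar> \<le> fact CARD('m) * norm A ^ CARD('m)"
proof -
  have entry: "\<bar>A $ i $ j\<bar> \<le> norm A" for i j
    using component_le_norm_cart [of "A $ i" j] Finite_Cartesian_Product.norm_nth_le [of A i]
    by linarith
  have "\<bar>det A\<bar> \<le> (\<Sum>p\<in>{p. p permutes UNIV}. \<bar>of_int (sign p) * (\<Prod>i\<in>UNIV. A $ i $ p i)\<bar>)"
    unfolding det_def by (rule sum_abs)
  also have "\<dots> \<le> (\<Sum>p\<in>{p. p permutes (UNIV :: 'm set)}. norm A ^ CARD('m))"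
  proof (rule sum_mono)
    fix p :: "'m \<Rightarrow> 'm"
    have "\<bar>of_int (sign p) * (\<Prod>i\<in>UNIV. A $ i $ p i)\<bar> = (\<Prod>i\<in>UNIV. \<bar>A $ i $ p i\<bar>)"
      by (simp add: abs_mult abs_prod sign_def)
    also have "\<dots> \<le> (\<Prod>i\<in>(UNIV :: 'm set). norm A)"
      by (rule prod_mono) (simp add: entry)
    finally show "\<bar>of_int (sign p) * (\<Prod>i\<in>UNIV. A $ i $ p i)\<bar> \<le> norm A ^ CARD('m)"
      by simp
  qed
  also have "\<dots> = fact CARD('m) * norm A ^ CARD('m)"
    by (simp add: card_permutations)
  finally show ?thesis .
qed

subsection \<open>Rank-one updates\<close>

definition outer :: "real ^ 'm \<Rightarrow> real ^ 'm \<Rightarrow> real ^ 'm ^ 'm" where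
  "outer w u = (\<chi> i j. w $ i * u $ j)"

lemma outer_mult_vec: "outer w u *v x = (u \<bullet> x) *\<^sub>R w"
  by (simp add: outer_def matrix_vector_mult_def inner_vec_def vec_eq_iff sum_distrib_left
      mult.commute mult.left_commute)

lemma pos_semidef_outer: "pos_semidef_matrix (outer u u)"
  by (simp add: pos_semidef_matrix_def outer_mult_vec inner_commute)
    (simp add: outer_def transpose_def mult.commute)

text \<open>An orthogonal change of basis makes \<open>u\<close> a multiple of a coordinate vector; then only one
  column differs from the identity.\<close>

lemma det_mat_1_add_outer:
  fixes w u :: "real ^ 'm"
  shows "det (mat 1 + outer w u) = 1 + u \<bullet> w"
proof -
  fix k :: 'm
  define e :: "real ^ 'm" where "e = axis k 1"
  obtain f :: "real ^ 'm \<Rightarrow> real ^ 'm"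
    where f: "orthogonal_transformation f" "f u = norm u *\<^sub>R e"
    using orthogonal_transformation_exists [of u "norm u *\<^sub>R e"] by (auto simp: e_def)
  define Q where "Q = matrix f"
  have Qv: "Q *v x = f x" for x
    using f(1) by (simp add: Q_def orthogonal_transformation_linear)
  have Q: "orthogonal_matrix Q"
    using f(1) by (simp add: Q_def orthogonal_transformation_matrix)
  have detQ: "det (transpose Q) * det Q = 1"
    using Q by (metis det_I det_mul orthogonal_matrix)
  define w' where "w' = f w"
  have conj: "Q ** (mat 1 + outer w u) ** transpose Q = mat 1 + outer w' (f u)"
    (is "?L = ?R")
  proof -
    have "?L *v x = ?R *v x" for x
    proof -
      have QQ: "f (transpose Q *v x) = x"
        using Q by (metis Qv matrix_vector_mul_assoc matrix_vector_mul_lid orthogonal_matrix_def)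
      have "u \<bullet> (transpose Q *v x) = f u \<bullet> x"
        by (simp add: inner_matrix_vector_transpose Qv del: transpose_matrix_vector)
      moreover have "Q *v (y + c *\<^sub>R w) = f y + c *\<^sub>R w'" for y c
        by (simp add: matrix_vector_right_distrib matrix_vector_mult_scaleR Qv w'_def)
      ultimately show ?thesis
        by (simp add: matrix_vector_mult_add_rdistrib outer_mult_vec QQ
            del: transpose_matrix_vector flip: matrix_vector_mul_assoc)
    qed
    then show ?thesis by (simp add: matrix_eq)
  qed
  have "det (mat 1 + outer w u) = det ?R"
    using detQ by (simp add: det_mul mult_ac flip: conj)
  \<comment> \<open>The identity with column \<open>k\<close> replaced; multiplying by
    \<open>mat 1\<close> gives the shape that \<open>cramer_lemma\<close> expects.\<close>
  also have "?R = (\<chi> i j. if j = k then (mat 1 *v (e + norm u *\<^sub>R w')) $ i else mat 1 $ i $ j)"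
    by (simp only: matrix_vector_mul_lid) (auto simp: vec_eq_iff outer_def f(2) e_def mat_def axis_def)
  also have "det \<dots> = 1 + norm u * w' $ k"
    by (simp add: cramer_lemma e_def axis_def del: matrix_vector_mul_lid)
  also have "norm u * w' $ k = f u \<bullet> f w"
    by (simp add: f(2) e_def w'_def inner_axis')
  also have "\<dots> = u \<bullet> w"
    using f(1) by (simp add: orthogonal_transformation_def)
  finally show ?thesis .
qed

text \<open>The matrix determinant lemma, stated with a preimage \<open>w\<close> of
  \<open>u\<close> in place of an inverse: \<open>A\<close> factors out on the left.\<close>

lemma det_add_outer:
  fixes A :: "real ^ 'm ^ 'm"
  assumes "A *v w = u"
  shows "det (A + outer u v) = det A * (1 + v \<bullet> w)"
proof -
  have "A + outer u v = A ** (mat 1 + outer w v)"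
    by (simp add: matrix_eq assms matrix_vector_mult_add_rdistrib outer_mult_vec
        matrix_vector_right_distrib matrix_vector_mult_scaleR flip: matrix_vector_mul_assoc)
  then show ?thesis by (simp add: det_mul det_mat_1_add_outer)
qed

text \<open>For \<open>A *v w = u\<close> the factor is \<open>1 + w \<bullet> (A *v w)\<close>,
  which exceeds 1.\<close>

lemma det_add_outer_gt:
  fixes A :: "real ^ 'm ^ 'm"
  assumes A: "pos_def_matrix A" and "u \<noteq> 0"
  shows "det A < det (A + outer u u)"
proof -
  have "invertible A"
    using A by (simp add: invertible_det_nz pos_def_iff_invertible)
  then obtain w where w: "A *v w = u"
    by (metis invertible_right_inverse matrix_vector_mul_assoc matrix_vector_mul_lid)
  with \<open>u \<noteq> 0\<close> have "w \<noteq> 0" by auto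
  then have "0 < u \<bullet> w"
    using A by (metis inner_commute pos_def_matrix_def w)
  with pos_def_det_pos [OF A] show ?thesis
    by (simp add: det_add_outer [OF w] algebra_simps)
qed

subsection \<open>Existence of the maximum likelihood estimator\<close>

lemma trace_sample_covariance:
  fixes x :: "nat \<Rightarrow> real ^ 'm"
  shows "trace (sample_covariance n x ** K) = (1 / real n) * (\<Sum>k = 1..n. x k \<bullet> (K *v x k))"
proof -
  have "trace (sample_covariance n x ** K)
      = (\<Sum>i\<in>UNIV. \<Sum>j\<in>UNIV. \<Sum>k = 1..n. (1 / real n) * (x k $ i * x k $ j * K $ j $ i))"
    by (simp add: trace_def matrix_matrix_mult_def sample_covariance_def sum_distrib_left
        sum_distrib_right sum_divide_distrib mult_ac)
  also have "\<dots> = (\<Sum>k = 1..n. \<Sum>i\<in>UNIV. \<Sum>j\<in>UNIV. (1 / real n) * (x k $ i * x k $ j * K $ j $ i))"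
    by (subst sum.swap, subst sum.swap) (simp add: sum.swap [of _ _ "{1..n}"])
  also have "\<dots> = (\<Sum>k = 1..n. \<Sum>i\<in>UNIV. \<Sum>j\<in>UNIV. (1 / real n) * (x k $ j * x k $ i * K $ i $ j))"
    by (subst (2) sum.swap) simp
  also have "\<dots> = (1 / real n) * (\<Sum>k = 1..n. x k \<bullet> (K *v x k))"
    by (simp add: inner_vec_def matrix_vector_mult_def sum_distrib_left mult_ac)
  finally show ?thesis .
qed

text \<open>Only equations and weak inequalities occur. Positive definiteness is not a closed
  condition, so the maximum is sought on this larger cone.\<close>

lemma closed_pos_semidef: "closed {A :: real ^ 'm ^ 'm. pos_semidef_matrix A}"
proof -
  have "{A :: real ^ 'm ^ 'm. pos_semidef_matrix A} =
      {A. \<forall>i j. A $ j $ i = A $ i $ j} \<inter> {A. \<forall>x. 0 \<le> x \<bullet> (A *v x)}"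
    by (auto simp: pos_semidef_matrix_def transpose_def vec_eq_iff)
  also have "closed \<dots>"
    by (intro closed_Int closed_Collect_all closed_Collect_eq closed_Collect_le continuous_intros)
  finally show ?thesis .
qed

lemma power_mult_exp_neg_tendsto_0:
  fixes c :: real
  assumes "0 < c"
  shows "((\<lambda>r. r ^ N * exp (- (c * r))) \<longlongrightarrow> 0) at_top"
proof -
  have "filterlim (\<lambda>r. c * r) at_top at_top"
    using assms by (intro filterlim_tendsto_pos_mult_at_top [OF tendsto_const] filterlim_ident)
  from filterlim_compose [OF tendsto_power_div_exp_0 this]
  have "((\<lambda>r. (1 / c ^ N) * ((c * r) ^ N / exp (c * r))) \<longlongrightarrow> (1 / c ^ N) * 0) at_top"
    by (intro tendsto_intros)
  with assms show ?thesis
    by (simp add: power_mult_distrib exp_minus field_simps)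
qed

text \<open>The hypothesis makes \<open>trace (S ** K)\<close> grow linearly on the cone of positive semidefinite
  matrices supported on the graph, so \<open>det K * exp (- trace (S ** K))\<close> attains its maximum there,
  necessarily at a positive definite matrix.\<close>

lemma mle_existsI:
  fixes x :: "nat \<Rightarrow> real ^ 'm"
  assumes n: "1 \<le> n"
    and ker: "\<And>K. \<lbrakk>pos_semidef_matrix K; \<And>i j. (i, j) \<notin> model_edges G \<Longrightarrow> K $ i $ j = 0;
      \<And>k. k \<in> {1..n} \<Longrightarrow> K *v x k = 0\<rbrakk> \<Longrightarrow> K = 0"
  shows "mle_exists G n x"
proof -
  define C :: "(real ^ 'm ^ 'm) set" where
    "C = {K. pos_semidef_matrix K \<and> (\<forall>i j. (i, j) \<notin> model_edges G \<longrightarrow> K $ i $ j = 0)}"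
  define T where "T K = trace (sample_covariance n x ** K)" for K
  \<comment> \<open>The exponentiated log-likelihood extends continuously to the singular matrices
    of the cone, with value 0.\<close>
  define f where "f K = det K * exp (- T K)" for K
  have T_eq: "T K = (1 / real n) * (\<Sum>k = 1..n. x k \<bullet> (K *v x k))" for K
    by (simp add: T_def trace_sample_covariance)
  have conc: "concentration_matrices G = {K \<in> C. det K \<noteq> 0}"
    by (auto simp: concentration_matrices_def C_def pos_def_iff_invertible)
  have f_exp: "f K = exp (log_likelihood (sample_covariance n x) K)"
    if "K \<in> concentration_matrices G" for K
  proof -
    have "0 < det K"
      using that by (intro pos_def_det_pos) (simp add: concentration_matrices_def)
    then show ?thesis
      by (simp add: f_def T_def log_likelihood_def exp_diff exp_minus divide_inverse)
  qed
  have closedC: "closed C"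
  proof -
    have "C = {K. pos_semidef_matrix K} \<inter> {K. \<forall>i j. (i, j) \<notin> model_edges G \<longrightarrow> K $ i $ j = 0}"
      by (auto simp: C_def)
    also have "closed \<dots>"
      by (intro closed_Int closed_pos_semidef closed_Collect_all closed_Collect_imp
          closed_Collect_eq continuous_intros) auto
    finally show ?thesis .
  qed
  have contT: "continuous_on S T" for S
    unfolding T_eq by (intro continuous_intros)
  have contf: "continuous_on S f" for S
    unfolding f_def by (intro continuous_intros contT)
  \<comment> \<open>\<open>T K\<close> is a positive multiple of a sum of nonnegative terms; if it
    is not positive, \<open>K\<close> annihilates every observation and \<open>ker\<close>
    applies.\<close>
  have T_pos: "0 < T K" if K: "K \<in> C" "K \<noteq> 0" for K
  proof (rule ccontr)
    have psd: "pos_semidef_matrix K" using K by (simp add: C_def)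
    then have nonneg: "0 \<le> x k \<bullet> (K *v x k)" for k
      by (simp add: pos_semidef_matrix_def)
    assume "\<not> 0 < T K"
    with n have "(\<Sum>k = 1..n. x k \<bullet> (K *v x k)) \<le> 0"
      by (simp add: T_eq not_less divide_le_0_iff)
    with nonneg have "(\<Sum>k = 1..n. x k \<bullet> (K *v x k)) = 0"
      by (meson order_antisym sum_nonneg)
    with nonneg have "x k \<bullet> (K *v x k) = 0" if "k \<in> {1..n}" for k
      using that by (simp add: sum_nonneg_eq_0_iff)
    with psd have "K *v x k = 0" if "k \<in> {1..n}" for k
      using that by (blast intro: pos_semidef_kernel)
    with K psd have "K = 0" by (intro ker) (auto simp: C_def)
    with K show False by simp
  qed
  have I: "mat 1 \<in> concentration_matrices G"
    by (auto simp: concentration_matrices_def pos_def_mat_1) (auto simp: model_edges_def mat_def)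
  \<comment> \<open>\<open>T\<close> is homogeneous, so its positive minimum on the compact unit
    slice of the cone serves as \<open>c\<close>.\<close>
  obtain c where c: "0 < c" "\<And>K. K \<in> C \<Longrightarrow> c * norm K \<le> T K"
  proof -
    have comp: "compact (C \<inter> sphere 0 1)"
      using closedC by (simp add: closed_Int_compact)
    have unit: "(1 / norm K) *\<^sub>R K \<in> C \<inter> sphere 0 1" if "K \<in> C" "K \<noteq> 0" for K
      using that by (auto simp: C_def pos_semidef_scaleR)
    have "mat 1 \<in> C" "mat 1 \<noteq> (0 :: real ^ 'm ^ 'm)"
      using I by (auto simp: conc vec_eq_iff mat_def)
    then have ne: "C \<inter> sphere 0 1 \<noteq> {}" using unit by blast
    obtain K0 where K0: "K0 \<in> C \<inter> sphere 0 1"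
        "\<And>K. K \<in> C \<inter> sphere 0 1 \<Longrightarrow> T K0 \<le> T K"
      using continuous_attains_inf [OF comp ne contT] by blast
    have "T K0 * norm K \<le> T K" if "K \<in> C" for K
    proof (cases "K = 0")
      case False
      have "T ((1 / norm K) *\<^sub>R K) = T K / norm K"
        by (simp add: T_eq sum_distrib_left sum_divide_distrib flip: scaleR_matrix_vector_assoc)
      with K0(2) [OF unit [OF that False]] False show ?thesis
        by (simp add: field_simps)
    qed (simp add: T_eq)
    moreover have "0 < T K0"
      using K0(1) by (intro T_pos) auto
    ultimately show ?thesis using that by blast
  qed
  have fI: "0 < f (mat 1)" by (simp add: f_def)
  obtain R where R: "\<And>r. R \<le> r \<Longrightarrow> fact CARD('m) * (r ^ CARD('m) * exp (- (c * r))) < f (mat 1)"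
  proof -
    have "((\<lambda>r. fact CARD('m) * (r ^ CARD('m) * exp (- (c * r)))) \<longlongrightarrow> fact CARD('m) * 0) at_top"
      by (intro tendsto_intros power_mult_exp_neg_tendsto_0 c)
    with fI have "\<forall>\<^sub>F r in at_top. fact CARD('m) * (r ^ CARD('m) * exp (- (c * r))) < f (mat 1)"
      by (intro order_tendstoD) auto
    with that show ?thesis by (auto simp: eventually_at_top_linorder)
  qed
  have far: "f K < f (mat 1)" if "K \<in> C" "R \<le> norm K" for K
  proof -
    have "f K \<le> (fact CARD('m) * norm K ^ CARD('m)) * exp (- (c * norm K))"
      unfolding f_def using c(2) [OF that(1)] det_le_norm_power [of K]
      by (intro mult_mono) auto
    also have "\<dots> < f (mat 1)"
      using R [OF that(2)] by (simp add: mult.assoc)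
    finally show ?thesis .
  qed
  \<comment> \<open>Outside the ball, \<open>far\<close> would give
    \<open>f (mat 1) < f (mat 1)\<close>.\<close>
  have mat_1: "mat 1 \<in> C \<inter> cball 0 R"
    using far [of "mat 1"] I by (force simp: conc)
  then have ne: "C \<inter> cball 0 R \<noteq> {}" by blast
  have comp: "compact (C \<inter> cball 0 R)"
    using closedC by (simp add: closed_Int_compact)
  obtain K where K: "K \<in> C \<inter> cball 0 R"
      "\<And>K'. K' \<in> C \<inter> cball 0 R \<Longrightarrow> f K' \<le> f K"
    using continuous_attains_sup [OF comp ne contf] by blast
  have "f (mat 1) \<le> f K" using K mat_1 by blast
  then have max: "f K' \<le> f K" if "K' \<in> C" for K'
    using that K(2) [of K'] far [of K'] by force
  \<comment> \<open>A singular maximiser would have value 0, below \<open>f (mat 1)\<close>.\<close>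
  have "det K \<noteq> 0"
    using fI \<open>f (mat 1) \<le> f K\<close> by (auto simp: f_def)
  with K have "K \<in> concentration_matrices G" by (simp add: conc)
  moreover have "log_likelihood (sample_covariance n x) K' \<le> log_likelihood (sample_covariance n x) K"
    if "K' \<in> concentration_matrices G" for K'
    using max [of K'] that \<open>K \<in> concentration_matrices G\<close> f_exp by (simp add: conc)
  ultimately show ?thesis unfolding mle_exists_def by blast
qed

text \<open>The hypothesis \<open>edges\<close> says that the support of \<open>u\<close> is a
  clique, so \<open>outer u u\<close> has the zero pattern of the graph.\<close>

lemma not_mle_existsI:
  fixes x :: "nat \<Rightarrow> real ^ 'm"
  assumes u: "u \<noteq> 0" "\<And>k. k \<in> {1..n} \<Longrightarrow> u \<bullet> x k = 0"
    and edges: "\<And>i j. (i, j) \<notin> model_edges G \<Longrightarrow> u $ i * u $ j = 0"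
  shows "\<not> mle_exists G n x"
proof
  assume "mle_exists G n x"
  then obtain K where K: "K \<in> concentration_matrices G"
      "\<And>K'. K' \<in> concentration_matrices G \<Longrightarrow>
        log_likelihood (sample_covariance n x) K' \<le> log_likelihood (sample_covariance n x) K"
    unfolding mle_exists_def by blast
  have pd: "pos_def_matrix K" using K by (simp add: concentration_matrices_def)
  have "K + outer u u \<in> concentration_matrices G"
    using K(1) edges pos_def_add_pos_semidef [OF pd pos_semidef_outer]
    by (auto simp: concentration_matrices_def outer_def)
  from K(2) [OF this] have "ln (det (K + outer u u)) \<le> ln (det K)"
    by (simp add: log_likelihood_def trace_sample_covariance matrix_vector_mult_add_rdistrib
        outer_mult_vec u(2))
  with det_add_outer_gt [OF pd u(1)] pos_def_det_pos [OF pd] show False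
    by simp
qed

subsection \<open>General position of Gaussian observations\<close>

lemma centred_normal_AE_hyperplane:
  fixes a :: "real ^ 'm"
  assumes "a \<noteq> 0"
  shows "AE x in centred_normal \<Sigma>. a \<bullet> x \<noteq> 0"
proof -
  have cont: "continuous_on UNIV (\<lambda>x. matrix_inv \<Sigma> *v x)"
    by (simp add: linear_continuous_on)
  have meas: "(\<lambda>x. ennreal (exp (- (x \<bullet> (matrix_inv \<Sigma> *v x)) / 2) /
      sqrt ((2 * pi) ^ CARD('m) * det \<Sigma>))) \<in> borel_measurable lborel"
  proof -
    have "continuous_on UNIV (\<lambda>x. exp (- (x \<bullet> (matrix_inv \<Sigma> *v x)) / 2))"
      by (intro continuous_intros cont) simp
    then have "(\<lambda>x. exp (- (x \<bullet> (matrix_inv \<Sigma> *v x)) / 2)) \<in> borel_measurable lborel"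
      by (simp add: borel_measurable_continuous_onI)
    then show ?thesis
      by (intro measurable_compose [OF _ measurable_ennreal] borel_measurable_divide
          borel_measurable_const)
  qed
  have "{x. a \<bullet> x = 0} \<in> null_sets lborel"
  proof -
    have "{x. a \<bullet> x = 0} \<in> null_sets lebesgue"
      using assms negligible_hyperplane [of a 0] by (simp add: negligible_iff_null_sets)
    moreover have "{x. a \<bullet> x = 0} \<in> sets lborel"
      by (simp add: closed_hyperplane borel_closed)
    ultimately show ?thesis
      by (simp add: null_sets_def)
  qed
  then have "AE x in lborel. a \<bullet> x \<noteq> 0"
    using AE_not_in by fastforce
  then show ?thesis
    unfolding centred_normal_def AE_density [OF meas] by eventually_elim blast
qed

text \<open>By independence the joint law is a product, and for each fixed
  \<open>y \<noteq> 0\<close> the exceptional set of \<open>z\<close> is null.\<close>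

lemma (in prob_space) AE_inner_nonzero:
  fixes Y Z :: "'a \<Rightarrow> real ^ 'm"
  assumes ind: "indep_var borel Y borel Z" and Y: "AE \<omega> in M. Y \<omega> \<noteq> 0"
    and Z: "\<And>a. a \<noteq> 0 \<Longrightarrow> AE z in distr M borel Z. a \<bullet> z \<noteq> 0"
  shows "AE \<omega> in M. Y \<omega> \<bullet> Z \<omega> \<noteq> 0"
proof -
  have rv [measurable]: "random_variable borel Y" "random_variable borel Z"
    using ind by (auto dest: indep_var_rv1 indep_var_rv2)
  have joint: "distr M borel Y \<Otimes>\<^sub>M distr M borel Z
      = distr M (borel \<Otimes>\<^sub>M borel) (\<lambda>\<omega>. (Y \<omega>, Z \<omega>))"
    using ind by (simp add: indep_var_distribution_eq)
  interpret Y: prob_space "distr M borel Y" by (rule prob_space_distr) simp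
  interpret Z: prob_space "distr M borel Z" by (rule prob_space_distr) simp
  interpret pair_prob_space "distr M borel Y" "distr M borel Z" ..
  have sets: "{p \<in> space (distr M borel Y \<Otimes>\<^sub>M distr M borel Z). fst p \<bullet> snd p \<noteq> 0}
      \<in> sets (distr M borel Y \<Otimes>\<^sub>M distr M borel Z)"
    by measurable
  have "AE y in distr M borel Y. y \<noteq> 0"
    using Y by (subst AE_distr_iff) auto
  then have "AE y in distr M borel Y. AE z in distr M borel Z. y \<bullet> z \<noteq> 0"
    by eventually_elim (rule Z)
  then have "AE p in distr M borel Y \<Otimes>\<^sub>M distr M borel Z. fst p \<bullet> snd p \<noteq> 0"
    using sets by (intro AE_pair_measure) simp_all
  then show ?thesis
    unfolding joint by (subst (asm) AE_distr_iff) auto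
qed

text \<open>The determinant of the rows \<open>i\<close>, \<open>j\<close>, \<open>l\<close> of the matrix with columns \<open>p\<close>, \<open>q\<close>, \<open>r\<close>,
  expanded along \<open>r\<close>.\<close>

definition minor3 :: "real ^ 'm \<Rightarrow> real ^ 'm \<Rightarrow> real ^ 'm \<Rightarrow> 'm \<Rightarrow> 'm \<Rightarrow> 'm \<Rightarrow> real" where
  "minor3 p q r i j l = (p $ i * q $ j - p $ j * q $ i) * r $ l
     + (p $ j * q $ l - p $ l * q $ j) * r $ i + (p $ l * q $ i - p $ i * q $ l) * r $ j"

text \<open>The observations are adjoined one at a time: for given \<open>p\<close> the \<open>2 \<times> 2\<close> minor is a linear
  form in \<open>q\<close>, for given \<open>p\<close> and \<open>q\<close> the \<open>3 \<times> 3\<close> minor is a linear form in \<open>r\<close>, and each of these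
  forms is almost surely nonzero by the preceding step.\<close>

lemma (in prob_space) AE_minor3_nonzero:
  fixes X :: "nat \<Rightarrow> 'a \<Rightarrow> real ^ 'm"
  assumes ind: "indep_vars (\<lambda>_. borel) X I" and I: "{a, b, c} \<subseteq> I" "distinct [a, b, c]"
    and P: "\<And>k v. \<lbrakk>k \<in> I; v \<noteq> 0\<rbrakk> \<Longrightarrow> AE z in distr M borel (X k). v \<bullet> z \<noteq> 0"
    and ijl: "distinct [i, j, l]"
  shows "AE \<omega> in M. minor3 (X a \<omega>) (X b \<omega>) (X c \<omega>) i j l \<noteq> 0"
proof -
  \<comment> \<open>Coefficient vectors: \<open>Y2 p \<bullet> q\<close> is the minor of rows
    \<open>i\<close>, \<open>j\<close>, and \<open>Y3 p q \<bullet> r\<close> is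
    \<open>minor3 p q r i j l\<close>. Coordinate \<open>j\<close> of \<open>Y2 p\<close> is
    \<open>p $ i\<close>, and coordinate \<open>l\<close> of \<open>Y3 p q\<close> is the preceding
    minor, so nonvanishing passes on.\<close>
  define Y2 where "Y2 p = p $ i *\<^sub>R axis j 1 - p $ j *\<^sub>R axis i (1 :: real)" for p :: "real ^ 'm"
  define Y3 where "Y3 p q = (p $ i * q $ j - p $ j * q $ i) *\<^sub>R axis l 1
    + (p $ j * q $ l - p $ l * q $ j) *\<^sub>R axis i 1
    + (p $ l * q $ i - p $ i * q $ l) *\<^sub>R axis j (1 :: real)" for p q :: "real ^ 'm"
  have nth [measurable]: "(\<lambda>v :: real ^ 'm. v $ k) \<in> borel_measurable borel" for k
    by (intro borel_measurable_continuous_onI continuous_intros)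
  have rv [measurable]: "random_variable borel (X k)" if "k \<in> I" for k
    using ind that by (auto simp: indep_vars_def)
  have "indep_var borel ((\<lambda>x. Y2 (x a)) \<circ> (\<lambda>\<omega>. restrict (\<lambda>k. X k \<omega>) {a}))
      borel ((\<lambda>x. x b) \<circ> (\<lambda>\<omega>. restrict (\<lambda>k. X k \<omega>) {b}))"
    using I unfolding Y2_def
    by (intro indep_var_compose [OF indep_var_restrict [OF ind]]) auto
  then have ind2: "indep_var borel (\<lambda>\<omega>. Y2 (X a \<omega>)) borel (X b)"
    by (simp add: comp_def)
  have "indep_var borel ((\<lambda>x. Y3 (x a) (x b)) \<circ> (\<lambda>\<omega>. restrict (\<lambda>k. X k \<omega>) {a, b}))
      borel ((\<lambda>x. x c) \<circ> (\<lambda>\<omega>. restrict (\<lambda>k. X k \<omega>) {c}))"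
    using I unfolding Y3_def
    by (intro indep_var_compose [OF indep_var_restrict [OF ind]]) auto
  then have ind3: "indep_var borel (\<lambda>\<omega>. Y3 (X a \<omega>) (X b \<omega>)) borel (X c)"
    by (simp add: comp_def)
  have "AE z in distr M borel (X a). axis i 1 \<bullet> z \<noteq> 0"
    using I by (intro P) (auto simp: axis_eq_0_iff)
  then have "AE \<omega> in M. X a \<omega> $ i \<noteq> 0"
    using I by (subst (asm) AE_distr_iff) (auto simp: inner_axis')
  then have "AE \<omega> in M. Y2 (X a \<omega>) \<noteq> 0"
  proof eventually_elim
    case (elim \<omega>)
    then have "Y2 (X a \<omega>) $ j \<noteq> 0" using ijl by (auto simp: Y2_def axis_def)
    then show ?case by auto
  qed
  then have "AE \<omega> in M. Y2 (X a \<omega>) \<bullet> X b \<omega> \<noteq> 0"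
    using I by (intro AE_inner_nonzero [OF ind2] P) auto
  then have "AE \<omega> in M. Y3 (X a \<omega>) (X b \<omega>) \<noteq> 0"
  proof eventually_elim
    case (elim \<omega>)
    then have "X a \<omega> $ i * X b \<omega> $ j - X a \<omega> $ j * X b \<omega> $ i \<noteq> 0"
      by (simp add: Y2_def inner_diff_left inner_axis')
    then have "Y3 (X a \<omega>) (X b \<omega>) $ l \<noteq> 0"
      using ijl by (auto simp: Y3_def axis_def)
    then show ?case by auto
  qed
  then have "AE \<omega> in M. Y3 (X a \<omega>) (X b \<omega>) \<bullet> X c \<omega> \<noteq> 0"
    using I by (intro AE_inner_nonzero [OF ind3] P) auto
  then show ?thesis
    by (simp add: Y3_def minor3_def inner_add_left inner_axis')
qed

text \<open>The three possible nonzero entries of row \<open>v\<close> solve a homogeneous 3 by 3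
  system with nonzero determinant.\<close>

lemma row_eq_0_if_minor3_nonzero:
  fixes K :: "real ^ 'm ^ 'm"
  assumes ker: "K *v p = 0" "K *v q = 0" "K *v r = 0"
    and minor: "minor3 p q r i j l \<noteq> 0" and ijl: "distinct [i, j, l]"
    and supp: "\<And>w. w \<notin> {i, j, l} \<Longrightarrow> K $ v $ w = 0"
  shows "K $ v $ w = 0"
proof -
  have eq: "K $ v $ i * y $ i + K $ v $ j * y $ j + K $ v $ l * y $ l = 0" if "K *v y = 0" for y
  proof -
    have "0 = (\<Sum>w\<in>UNIV. K $ v $ w * y $ w)"
      using that by (simp add: matrix_vector_mult_def vec_eq_iff)
    also have "\<dots> = (\<Sum>w\<in>{i, j, l}. K $ v $ w * y $ w)"
      by (rule sum.mono_neutral_right) (auto simp: supp)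
    finally show ?thesis using ijl by (simp add: add.assoc)
  qed
  have "K $ v $ i * minor3 p q r i j l = 0" "K $ v $ j * minor3 p q r i j l = 0"
      "K $ v $ l * minor3 p q r i j l = 0"
    unfolding minor3_def using eq [OF ker(1)] eq [OF ker(2)] eq [OF ker(3)] by algebra+
  with minor supp show ?thesis by (cases "w \<in> {i, j, l}") auto
qed

subsection \<open>The grid\<close>

text \<open>The value is unspecified for coordinates outside 1 to 3, hence the range assumptions
  below.\<close>

definition cell :: "int \<Rightarrow> int \<Rightarrow> grid_vertex" where
  "cell a b = Abs_grid_vertex (a, b)"

lemma cell_eq_iff:
  assumes "a \<in> {1..3}" "b \<in> {1..3}" "c \<in> {1..3}" "d \<in> {1..3}"
  shows "cell a b = cell c d \<longleftrightarrow> a = c \<and> b = d"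
  using assms by (simp add: cell_def Abs_grid_vertex_inject)

lemma cell_exhaust:
  obtains a b where "v = cell a b" "a \<in> {1..3}" "b \<in> {1..3}"
  using that Rep_grid_vertex [of v] Rep_grid_vertex_inverse [of v]
  by (cases "Rep_grid_vertex v") (auto simp: cell_def)

lemma cell_in_model_edges_iff:
  assumes "a \<in> {1..3}" "b \<in> {1..3}" "c \<in> {1..3}" "d \<in> {1..3}"
  shows "(cell a b, cell c d) \<in> model_edges grid_graph \<longleftrightarrow> \<bar>a - c\<bar> + \<bar>b - d\<bar> \<le> 1"
proof -
  have "(cell a b, cell c d) \<in> grid_graph \<longleftrightarrow> \<bar>a - c\<bar> + \<bar>b - d\<bar> = 1"
    using assms by (simp add: grid_graph_def cell_def Abs_grid_vertex_inverse)
  moreover have "cell a b = cell c d \<longleftrightarrow> \<bar>a - c\<bar> + \<bar>b - d\<bar> = 0"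
    using assms by (auto simp: cell_eq_iff)
  ultimately show ?thesis
    by (auto simp: model_edges_def)
qed

lemma grid_matrix_eq_0:
  fixes K :: "real ^ grid_vertex ^ grid_vertex"
  assumes sym: "transpose K = K"
    and supp: "\<And>v w. (v, w) \<notin> model_edges grid_graph \<Longrightarrow> K $ v $ w = 0"
    and ker: "K *v p = 0" "K *v q = 0" "K *v r = 0"
    and minor: "\<And>i j l. distinct [i, j, l] \<Longrightarrow> minor3 p q r i j l \<noteq> 0"
  shows "K = 0"
proof -
  have K_sym: "K $ v $ w = K $ w $ v" for v w
    using sym by (metis transpose_def vec_lambda_beta)
  have row: "K $ v $ w = 0"
    if "distinct [i, j, l]" "\<And>w. w \<notin> {i, j, l} \<Longrightarrow> K $ v $ w = 0" for v w i j l
    using row_eq_0_if_minor3_nonzero [OF ker minor] that by blast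
  have far: "K $ cell a b $ cell c d = 0"
    if "a \<in> {1..3}" "b \<in> {1..3}" "c \<in> {1..3}" "d \<in> {1..3}" "1 < \<bar>a - c\<bar> + \<bar>b - d\<bar>" for a b c d
    using that by (intro supp) (simp add: cell_in_model_edges_iff)
  \<comment> \<open>The three columns are the corner and its two neighbours.\<close>
  have corner: "K $ cell a b $ w = 0" if "a \<in> {1, 3}" "b \<in> {1, 3}" for a b w
  proof (rule row [of "cell a b" "cell 2 b" "cell a 2"])
    show "distinct [cell a b, cell 2 b, cell a 2]"
      using that by (auto simp: cell_eq_iff)
    fix w assume w: "w \<notin> {cell a b, cell 2 b, cell a 2}"
    obtain c d where cd: "w = cell c d" "c \<in> {1..3}" "d \<in> {1..3}" by (rule cell_exhaust)
    have "1 < \<bar>a - c\<bar> + \<bar>b - d\<bar>"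
    proof (rule ccontr)
      assume "\<not> 1 < \<bar>a - c\<bar> + \<bar>b - d\<bar>"
      with that cd(2,3) have "c = a \<and> d = b \<or> c = 2 \<and> d = b \<or> c = a \<and> d = 2" by auto
      with w cd show False by auto
    qed
    with that cd show "K $ cell a b $ w = 0" by (auto intro!: far)
  qed
  have mid: "K $ cell a b $ w = 0"
    if "a \<in> {1..3}" "b \<in> {1..3}" "\<bar>a - 2\<bar> + \<bar>b - 2\<bar> = 1" for a b w
  \<comment> \<open>By symmetry the corner columns vanish too. Only the midpoint and the centre
    remain; \<open>cell 1 1\<close> merely completes a triple of distinct vertices.\<close>
  proof (rule row [of "cell a b" "cell 2 2" "cell 1 1"])
    show "distinct [cell a b, cell 2 2, cell 1 1]"
      using that by (auto simp: cell_eq_iff)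
    fix w assume w: "w \<notin> {cell a b, cell 2 2, cell 1 1}"
    obtain c d where cd: "w = cell c d" "c \<in> {1..3}" "d \<in> {1..3}" by (rule cell_exhaust)
    show "K $ cell a b $ w = 0"
    proof (cases "c \<in> {1, 3} \<and> d \<in> {1, 3}")
      case True
      then show ?thesis using cd corner K_sym by metis
    next
      case False
      have "1 < \<bar>a - c\<bar> + \<bar>b - d\<bar>"
      proof (rule ccontr)
        assume "\<not> 1 < \<bar>a - c\<bar> + \<bar>b - d\<bar>"
        with that cd(2,3) False have "c = a \<and> d = b \<or> c = 2 \<and> d = 2" by auto
        with w cd show False by auto
      qed
      with that cd show ?thesis by (auto intro!: far)
    qed
  qed
  have centre: "K $ cell 2 2 $ w = 0" for w
  \<comment> \<open>Only the diagonal entry is left; the other two vertices are fillers.\<close>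
  proof (rule row [of "cell 2 2" "cell 1 1" "cell 1 2"])
    show "distinct [cell 2 2, cell 1 1, cell 1 2]"
      by (auto simp: cell_eq_iff)
    fix w assume w: "w \<notin> {cell 2 2, cell 1 1, cell 1 2}"
    obtain c d where cd: "w = cell c d" "c \<in> {1..3}" "d \<in> {1..3}" by (rule cell_exhaust)
    show "K $ cell 2 2 $ w = 0"
    proof (cases "c \<in> {1, 3} \<and> d \<in> {1, 3}")
      case True
      then show ?thesis using cd corner K_sym by metis
    next
      case False
      with w cd have "\<bar>c - 2\<bar> + \<bar>d - 2\<bar> = 1" by (cases "c = 2"; cases "d = 2") auto
      then show ?thesis using cd mid K_sym by metis
    qed
  qed
  have "K $ v $ w = 0" for v w
  proof -
    obtain a b where ab: "v = cell a b" "a \<in> {1..3}" "b \<in> {1..3}" by (rule cell_exhaust)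
    then have "a \<in> {1, 3} \<and> b \<in> {1, 3} \<or> \<bar>a - 2\<bar> + \<bar>b - 2\<bar> = 1 \<or> a = 2 \<and> b = 2"
      by auto
    then consider "a \<in> {1, 3}" "b \<in> {1, 3}" | "\<bar>a - 2\<bar> + \<bar>b - 2\<bar> = 1" | "a = 2" "b = 2"
      by blast
    then show ?thesis by cases (use ab corner mid centre in auto)
  qed
  then show ?thesis by (simp add: vec_eq_iff)
qed

lemma grid_not_mle_exists: "\<not> mle_exists grid_graph 1 x"
proof -
  define v w where "v = cell 1 1" and "w = cell 1 2"
  have "v \<noteq> w" by (simp add: v_def w_def cell_eq_iff)
  \<comment> \<open>The case split keeps \<open>u\<close> nonzero: the second vector has
    \<open>w\<close>-coordinate \<open>- x 1 $ v\<close>.\<close>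
  define u :: "real ^ grid_vertex" where
    "u = (if x 1 $ v = 0 then axis v 1 else x 1 $ w *\<^sub>R axis v 1 - x 1 $ v *\<^sub>R axis w 1)"
  show ?thesis
  proof (rule not_mle_existsI [of u])
    have "u $ v \<noteq> 0 \<or> u $ w \<noteq> 0"
      using \<open>v \<noteq> w\<close> by (auto simp: u_def axis_def)
    then show "u \<noteq> 0" by auto
    show "u \<bullet> x k = 0" if "k \<in> {1..1}" for k
      using that by (simp add: u_def inner_diff_left inner_axis')
    fix i j assume ij: "(i, j) \<notin> model_edges grid_graph"
    have "{v, w} \<times> {v, w} \<subseteq> model_edges grid_graph"
      by (auto simp: v_def w_def cell_in_model_edges_iff)
    with ij have "i \<notin> {v, w} \<or> j \<notin> {v, w}" by auto
    then show "u $ i * u $ j = 0"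
      by (auto simp: u_def axis_def)
  qed
qed

theorem corollary5p3:
  "(\<forall>n \<ge> 3. \<forall>P \<in> gaussian_graphical_model grid_graph.
      \<forall>(M :: 'a measure) (X :: nat \<Rightarrow> 'a \<Rightarrow> real ^ grid_vertex).
        prob_space M \<longrightarrow>
        prob_space.indep_vars M (\<lambda>_. borel) X {1..n} \<longrightarrow>
        (\<forall>k \<in> {1..n}. distr M borel (X k) = P) \<longrightarrow>
        (AE \<omega> in M. mle_exists grid_graph n (\<lambda>k. X k \<omega>))) \<and>
   (\<forall>n. 1 \<le> n \<and> n < 2 \<longrightarrow>
      (\<forall>x :: nat \<Rightarrow> real ^ grid_vertex. \<not> mle_exists grid_graph n x))"
proof (intro conjI allI ballI impI)
  fix n :: nat and P and M :: "'a measure" and X :: "nat \<Rightarrow> 'a \<Rightarrow> real ^ grid_vertex"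
  assume n: "3 \<le> n" and P: "P \<in> gaussian_graphical_model grid_graph" and M: "prob_space M"
    and ind: "prob_space.indep_vars M (\<lambda>_. borel) X {1..n}"
    and distr: "\<forall>k \<in> {1..n}. distr M borel (X k) = P"
  interpret prob_space M by (rule M)
  obtain \<Sigma> where \<Sigma>: "P = centred_normal \<Sigma>"
    using P by (auto simp: gaussian_graphical_model_def)
  \<comment> \<open>Distinctness stays inside the almost-sure statement so that the finitely many
    triples can be quantified there by \<open>AE_all_countable\<close>.\<close>
  have "AE \<omega> in M. distinct [i, j, l] \<longrightarrow> minor3 (X 1 \<omega>) (X 2 \<omega>) (X 3 \<omega>) i j l \<noteq> 0" for i j l
  proof (cases "distinct [i, j, l]")
    case True
    have "AE z in distr M borel (X k). v \<bullet> z \<noteq> 0" if "k \<in> {1..n}" "v \<noteq> 0" for k v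
      using that distr centred_normal_AE_hyperplane \<Sigma> by metis
    then have "AE \<omega> in M. minor3 (X 1 \<omega>) (X 2 \<omega>) (X 3 \<omega>) i j l \<noteq> 0"
      using n True by (intro AE_minor3_nonzero [OF ind]) auto
    then show ?thesis by eventually_elim simp
  next
    case False
    then show ?thesis by (intro AE_I2) blast
  qed
  then have "AE \<omega> in M. \<forall>i j l. distinct [i, j, l] \<longrightarrow>
      minor3 (X 1 \<omega>) (X 2 \<omega>) (X 3 \<omega>) i j l \<noteq> 0"
    unfolding AE_all_countable by blast
  then show "AE \<omega> in M. mle_exists grid_graph n (\<lambda>k. X k \<omega>)"
  proof eventually_elim
    case (elim \<omega>)
    show ?case
    proof (rule mle_existsI)
      show "1 \<le> n" using n by simp
      fix K :: "real ^ grid_vertex ^ grid_vertex"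
      assume "pos_semidef_matrix K" "\<And>i j. (i, j) \<notin> model_edges grid_graph \<Longrightarrow> K $ i $ j = 0"
        and ker: "\<And>k. k \<in> {1..n} \<Longrightarrow> K *v X k \<omega> = 0"
      \<comment> \<open>The first three observations already force \<open>K\<close> to
        vanish.\<close>
      then show "K = 0"
        using elim n
        by (intro grid_matrix_eq_0 [of K "X 1 \<omega>" "X 2 \<omega>" "X 3 \<omega>"])
          (auto simp: pos_semidef_matrix_def)
    qed
  qed
next
  fix n :: nat and x :: "nat \<Rightarrow> real ^ grid_vertex"
  assume "1 \<le> n \<and> n < 2"
  then have "n = 1" by simp
  then show "\<not> mle_exists grid_graph n x" using grid_not_mle_exists by blast
qed

end
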